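(* Let $P$ be a finite poset with $N$ elements and height $h$. The costs of computing the Möbius function $\mu$ of $P$ by the following methods are, for every such $P$: (1) Gaussian inversion in $\mathrm{Inc}(P)$ (classical method): $O(N^3)$; (2) the direct formula $\mu=\sum_{k=0}^{h}(-1)^k\eta^k$: $O(h\cdot N^2)$; (3) Newton's iteration in $\mathrm{Inc}(P)$: $O(\log h\cdot N^2)$.
   Context: The incidence algebra $\mathrm{Inc}(P)$ is the space of functions $f:\{(x,y)\in P^2:x\le y\}\to\mathbb{C}$ with convolution $(f*g)(x,y)=\sum_{x\le z\le y}f(x,z)g(z,y)$; $\zeta(x,y)=1$ for $x\le y$, $\varepsilon(x,y)=\mathbf{1}[x=y]$ is the identity, $\mu=\zeta^{-1}$, and $\eta=\zeta-\varepsilon$. Elements are represented as triangular $N\times N$ matrices. The height is $h=\max\{k:\exists\,x_0<\cdots<x_k\text{ in }P\}$. Newton's iteration for $\zeta^{-1}$ is $g_{k+1}=g_k*(2\varepsilon-\zeta*g_k)$. The paper's cost convention for the nilpotent operational system $(\mathrm{Inc}(P),\eta,h,O(N^2))$ is that a product in $\mathrm{Inc}(P)$ is assigned cost $O(N^2)$ scalar operations.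
   Formalization: In (3), O(log h · N²) is proved literally for h ≥ 2; for all P it is proved with log(h+1) in place of log h, since log h is 0 at h = 1, where a Newton step from ε is still needed, and undefined at h = 0. *)

theory Defs
  imports Complex_Main "HOL-Library.Landau_Symbols"
begin

text \<open>
  A poset is given by its order relation \<^term>\<open>r\<close>; by reflexivity its underlying set is
  \<^term>\<open>Field r\<close>.
\<close>

definition finite_posets :: "'a rel set" where
  "finite_posets = {r. Partial_order r \<and> finite (Field r)}"

text \<open>
  On \<^typ>\<open>nat\<close>, \<^term>\<open>Sup\<close> of a nonempty finite set is its maximum; the empty poset, which has no
  chains, gets height 0.
\<close>

definition height :: "'a rel \<Rightarrow> nat" where
  "height r = Sup {k. \<exists>x :: nat \<Rightarrow> 'a. (\<forall>i\<le>k. x i \<in> Field r) \<and>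
                        (\<forall>i<k. (x i, x (Suc i)) \<in> r \<and> x i \<noteq> x (Suc i))}"

definition linear_extension :: "'a rel \<Rightarrow> 'a list \<Rightarrow> bool" where
  "linear_extension r xs \<longleftrightarrow>
     distinct xs \<and> set xs = Field r \<and>
     (\<forall>i<length xs. \<forall>j<length xs. (xs ! i, xs ! j) \<in> r \<longrightarrow> i \<le> j)"


section \<open>The incidence algebra\<close>

text \<open>
  A function on the pairs of \<^term>\<open>r\<close> is extended by 0 to all pairs.  With the rows and columns
  ordered by a linear extension, the elements are thus upper triangular matrices.
\<close>

type_synonym 'a matrix = "'a \<Rightarrow> 'a \<Rightarrow> complex"

definition Inc :: "'a rel \<Rightarrow> 'a matrix set" where
  "Inc r = {f. \<forall>x y. (x, y) \<notin> r \<longrightarrow> f x y = 0}"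

definition conv :: "'a rel \<Rightarrow> 'a matrix \<Rightarrow> 'a matrix \<Rightarrow> 'a matrix" where
  "conv r f g = (\<lambda>x y. if (x, y) \<in> r
                       then \<Sum>z | (x, z) \<in> r \<and> (z, y) \<in> r. f x z * g z y else 0)"

definition zeta :: "'a rel \<Rightarrow> 'a matrix" where
  "zeta r = (\<lambda>x y. if (x, y) \<in> r then 1 else 0)"

definition eps :: "'a rel \<Rightarrow> 'a matrix" where
  "eps r = (\<lambda>x y. if x = y \<and> x \<in> Field r then 1 else 0)"

definition eta :: "'a rel \<Rightarrow> 'a matrix" where
  "eta r = (\<lambda>x y. zeta r x y - eps r x y)"

definition mobius :: "'a rel \<Rightarrow> 'a matrix" where
  "mobius r = (THE g. g \<in> Inc r \<and> conv r (zeta r) g = eps r \<and> conv r g (zeta r) = eps r)"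

primrec conv_power :: "'a rel \<Rightarrow> 'a matrix \<Rightarrow> nat \<Rightarrow> 'a matrix" where
  "conv_power r f 0 = eps r"
| "conv_power r f (Suc k) = conv r (conv_power r f k) f"


section \<open>Computations with a count of scalar operations\<close>

text \<open>
  A computation returns its result together with the number of arithmetic operations on complex
  scalars it performed.  Reading and storing entries, constants (such as the entries of
  \<^term>\<open>zeta r\<close> and \<^term>\<open>eps r\<close>) and control flow are free.
\<close>

type_synonym 'b counted = "'b \<times> nat"

abbreviation result :: "'b counted \<Rightarrow> 'b" where "result \<equiv> fst"
abbreviation cost :: "'b counted \<Rightarrow> nat" where "cost \<equiv> snd"

definition return :: "'b \<Rightarrow> 'b counted" where
  "return x = (x, 0)"

definition bind :: "'b counted \<Rightarrow> ('b \<Rightarrow> 'c counted) \<Rightarrow> 'c counted" (infixl "\<bind>" 54) where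
  "m \<bind> f = (result (f (result m)), cost m + cost (f (result m)))"

primrec for_each :: "'i list \<Rightarrow> ('i \<Rightarrow> 's \<Rightarrow> 's counted) \<Rightarrow> 's \<Rightarrow> 's counted" where
  "for_each [] body s = return s"
| "for_each (i # is) body s = body i s \<bind> for_each is body"

definition sub :: "complex \<Rightarrow> complex \<Rightarrow> complex counted" where
  "sub a b = (a - b, 1)"

definition mul :: "complex \<Rightarrow> complex \<Rightarrow> complex counted" where
  "mul a b = (a * b, 1)"

definition quot :: "complex \<Rightarrow> complex \<Rightarrow> complex counted" where
  "quot a b = (a / b, 1)"


section \<open>Gaussian inversion\<close>

text \<open>
  Gauss-Jordan elimination on the augmented matrix \<open>[A | B]\<close>, starting from \<open>[zeta | eps]\<close>; rows
  and columns are indexed by the list \<^term>\<open>xs\<close>.  There is no search for a pivot: a row exchange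
  would leave the incidence algebra, and the diagonal entries of an invertible element are nonzero.
  All rows are treated as dense.
\<close>

definition set_entry :: "'a \<Rightarrow> 'a \<Rightarrow> complex \<Rightarrow> 'a matrix \<Rightarrow> 'a matrix" where
  "set_entry i j v A = A(i := (A i)(j := v))"

definition divide_row :: "'a list \<Rightarrow> complex \<Rightarrow> 'a \<Rightarrow> 'a matrix \<Rightarrow> 'a matrix counted" where
  "divide_row xs p k =
     for_each xs (\<lambda>j A. quot (A k j) p \<bind> (\<lambda>v. return (set_entry k j v A)))"

definition subtract_row ::
    "'a list \<Rightarrow> complex \<Rightarrow> 'a \<Rightarrow> 'a \<Rightarrow> 'a matrix \<Rightarrow> 'a matrix counted" where
  "subtract_row xs c k i =
     for_each xs (\<lambda>j A. mul c (A k j) \<bind> (\<lambda>t. sub (A i j) t \<bind> (\<lambda>v. return (set_entry i j v A))))"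

definition pivot_step ::
    "'a list \<Rightarrow> 'a \<Rightarrow> 'a matrix \<times> 'a matrix \<Rightarrow> ('a matrix \<times> 'a matrix) counted" where
  "pivot_step xs k = (\<lambda>(A, B).
     divide_row xs (A k k) k A \<bind> (\<lambda>A'.
     divide_row xs (A k k) k B \<bind> (\<lambda>B'.
     for_each (filter (\<lambda>i. i \<noteq> k) xs)
       (\<lambda>i (A, B). subtract_row xs (A i k) k i A \<bind> (\<lambda>A'.
                    subtract_row xs (A i k) k i B \<bind> (\<lambda>B'. return (A', B'))))
       (A', B'))))"

definition gauss_mobius :: "'a rel \<Rightarrow> 'a list \<Rightarrow> 'a matrix counted" where
  "gauss_mobius r xs =
     for_each xs (pivot_step xs) (zeta r, eps r) \<bind> (\<lambda>(A, B). return B)"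


section \<open>Methods working with products in the incidence algebra\<close>

text \<open>
  Entrywise operations cost one scalar operation for each of the \<^term>\<open>card r\<close> entries.  The cost
  of a product is not derived but assigned: \<^term>\<open>pc r\<close> is the number of scalar operations charged
  for one product in \<^term>\<open>Inc r\<close>.
\<close>

definition inc_add :: "'a rel \<Rightarrow> 'a matrix \<Rightarrow> 'a matrix \<Rightarrow> 'a matrix counted" where
  "inc_add r f g = ((\<lambda>x y. f x y + g x y), card r)"

definition inc_sub :: "'a rel \<Rightarrow> 'a matrix \<Rightarrow> 'a matrix \<Rightarrow> 'a matrix counted" where
  "inc_sub r f g = ((\<lambda>x y. f x y - g x y), card r)"

definition inc_mult ::
    "('a rel \<Rightarrow> nat) \<Rightarrow> 'a rel \<Rightarrow> 'a matrix \<Rightarrow> 'a matrix \<Rightarrow> 'a matrix counted" where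
  "inc_mult pc r f g = (conv r f g, pc r)"

text \<open>The \<open>k\<close>-th power of \<open>e\<close> and the alternating sum of the powers up to \<open>k\<close>.\<close>

primrec power_sum ::
    "('a rel \<Rightarrow> nat) \<Rightarrow> 'a rel \<Rightarrow> 'a matrix \<Rightarrow> nat \<Rightarrow> ('a matrix \<times> 'a matrix) counted" where
  "power_sum pc r e 0 = return (eps r, eps r)"
| "power_sum pc r e (Suc k) =
     power_sum pc r e k \<bind> (\<lambda>(p, s).
     inc_mult pc r p e \<bind> (\<lambda>p'.
     (if even (Suc k) then inc_add r s p' else inc_sub r s p') \<bind> (\<lambda>s'.
     return (p', s'))))"

text \<open>In height 0 the sum is \<^term>\<open>eps r\<close>, and \<^term>\<open>eta r\<close> is not needed.\<close>

definition direct_mobius :: "('a rel \<Rightarrow> nat) \<Rightarrow> 'a rel \<Rightarrow> 'a matrix counted" where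
  "direct_mobius pc r =
     (if height r = 0 then return (eps r)
      else inc_sub r (zeta r) (eps r) \<bind> (\<lambda>e.
           power_sum pc r e (height r) \<bind> (\<lambda>(p, s). return s)))"

primrec newton_iterate :: "('a rel \<Rightarrow> nat) \<Rightarrow> 'a rel \<Rightarrow> nat \<Rightarrow> 'a matrix counted" where
  "newton_iterate pc r 0 = return (eps r)"
| "newton_iterate pc r (Suc k) =
     newton_iterate pc r k \<bind> (\<lambda>g.
     inc_mult pc r (zeta r) g \<bind> (\<lambda>t.
     inc_sub r (\<lambda>x y. 2 * eps r x y) t \<bind> (\<lambda>u.
     inc_mult pc r g u)))"

text \<open>
  The error of the \<open>k\<close>-th iterate is a multiple of the power of \<^term>\<open>eta r\<close> with exponent
  \<open>2 ^ k\<close>, so the iteration stops at the first \<open>k\<close> with \<open>2 ^ k \<ge> h + 1\<close>.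
\<close>

definition newton_mobius :: "('a rel \<Rightarrow> nat) \<Rightarrow> 'a rel \<Rightarrow> 'a matrix counted" where
  "newton_mobius pc r = newton_iterate pc r (nat \<lceil>log 2 (real (height r) + 1)\<rceil>)"

end

theory Submission
  imports Defs
begin

text \<open>
  Put \<open>\<delta> = \<epsilon> - \<zeta> = - \<eta>\<close>.  An element of the incidence algebra with zero diagonal is nilpotent: a
  nonzero entry \<open>(x, y)\<close> of its \<open>k\<close>-th power produces a strict chain with \<open>k\<close> steps ending in \<open>y\<close>
  (\<open>chain_if_conv_power_nonzero\<close>), so the powers beyond the height vanish (\<open>conv_power_eq_0\<close>).
  Hence the geometric series of \<open>\<delta>\<close>, cut off at the height, is a two-sided inverse of
  \<open>\<zeta> = \<epsilon> - \<delta>\<close>.  This is the direct formula; it also shows that \<open>\<mu>\<close> exists, so that for the two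
  other methods a one-sided inverse of \<open>\<zeta>\<close> is all that has to be exhibited (\<open>left_inverse_eq_mobius\<close>,
  \<open>right_inverse_eq_mobius\<close>).

  For Newton's iteration, \<open>\<epsilon> - \<zeta> * g\<close> is squared in every step and starts as \<open>\<delta>\<close>; after \<open>k\<close> steps it
  is \<open>\<delta>\<close> to the power \<open>2 ^ k\<close>, which is 0 as soon as \<open>2 ^ k\<close> exceeds the height.

  For Gaussian elimination, both halves of \<open>[A | B]\<close> stay in the incidence algebra, and \<open>A = B * \<zeta>\<close>
  is preserved by row operations.  The diagonal of \<open>A\<close> stays 1: the step with pivot \<open>k\<close> changes
  the entry \<open>(i, i)\<close> by \<open>A i k * A k i\<close>, which vanishes by antisymmetry.  So every pivot is 1, each
  step clears one column for good, and at the end \<open>A = \<epsilon>\<close>, that is, \<open>B * \<zeta> = \<epsilon>\<close>.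

  The costs are counted by following the loops: \<open>N\<close> pivots with at most \<open>N\<close> row operations of
  length \<open>O(N)\<close> each; \<open>h\<close> products and sums; and \<open>\<lceil>log 2 (h + 1)\<rceil>\<close> Newton steps with two products.
\<close>

section \<open>Products in the incidence algebra\<close>

lemma conv_diff_left:
  "conv r (\<lambda>x y. f x y - g x y) h = (\<lambda>x y. conv r f h x y - conv r g h x y)"
  by (simp add: fun_eq_iff conv_def sum_subtractf left_diff_distrib)

lemma conv_diff_right:
  "conv r h (\<lambda>x y. f x y - g x y) = (\<lambda>x y. conv r h f x y - conv r h g x y)"
  by (simp add: fun_eq_iff conv_def sum_subtractf right_diff_distrib)

lemma conv_sum_left:
  "conv r (\<lambda>x y. \<Sum>k\<in>K. f k x y) h = (\<lambda>x y. \<Sum>k\<in>K. conv r (f k) h x y)"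
  by (intro ext) (simp add: conv_def sum_distrib_right sum.swap[of _ _ K])

lemma conv_sum_right:
  "conv r h (\<lambda>x y. \<Sum>k\<in>K. f k x y) = (\<lambda>x y. \<Sum>k\<in>K. conv r h (f k) x y)"
  by (intro ext) (simp add: conv_def sum_distrib_left sum.swap[of _ _ K])

lemma conv_scale_left: "conv r (\<lambda>x y. c * f x y) h = (\<lambda>x y. c * conv r f h x y)"
  by (simp add: fun_eq_iff conv_def sum_distrib_left mult.assoc)

lemma conv_scale_right: "conv r h (\<lambda>x y. c * f x y) = (\<lambda>x y. c * conv r h f x y)"
  by (simp add: fun_eq_iff conv_def sum_distrib_left mult.left_commute)

lemma conv_power_scale:
  "conv_power r (\<lambda>x y. c * f x y) k = (\<lambda>x y. c ^ k * conv_power r f k x y)"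
  by (induction k) (simp_all add: conv_scale_left conv_scale_right mult_ac)

lemma conv_in_Inc: "conv r f g \<in> Inc r"
  by (simp add: Inc_def conv_def)

lemma diff_in_Inc: "f \<in> Inc r \<Longrightarrow> g \<in> Inc r \<Longrightarrow> (\<lambda>x y. f x y - g x y) \<in> Inc r"
  by (simp add: Inc_def)

lemma sum_in_Inc: "(\<And>k. k \<in> K \<Longrightarrow> f k \<in> Inc r) \<Longrightarrow> (\<lambda>x y. \<Sum>k\<in>K. f k x y) \<in> Inc r"
  by (simp add: Inc_def)

lemma zeta_in_Inc: "zeta r \<in> Inc r"
  by (simp add: Inc_def zeta_def)

locale finite_poset =
  fixes r :: "'a rel"
  assumes finite_poset: "r \<in> finite_posets"
begin

lemma finite_Field: "finite (Field r)"
  using finite_poset by (simp add: finite_posets_def)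

lemma refl_r: "x \<in> Field r \<Longrightarrow> (x, x) \<in> r"
  using finite_poset
  by (auto simp: finite_posets_def partial_order_on_def preorder_on_def refl_on_def)

lemma trans_r: "(x, y) \<in> r \<Longrightarrow> (y, z) \<in> r \<Longrightarrow> (x, z) \<in> r"
  using finite_poset
  by (auto simp: finite_posets_def partial_order_on_def preorder_on_def dest: transD)

lemma antisym_r: "(x, y) \<in> r \<Longrightarrow> (y, x) \<in> r \<Longrightarrow> x = y"
  using finite_poset
  by (auto simp: finite_posets_def partial_order_on_def dest: antisymD)

lemma card_r_le: "card r \<le> card (Field r) ^ 2"
proof -
  have "card r \<le> card (Field r \<times> Field r)"
    by (rule card_mono) (auto simp: finite_Field intro: FieldI1 FieldI2)
  then show ?thesis
    by (simp add: card_cartesian_product power2_eq_square)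
qed

lemma eps_in_Inc: "eps r \<in> Inc r"
  by (auto simp: Inc_def eps_def refl_r)

lemma conv_power_in_Inc: "conv_power r f k \<in> Inc r"
  by (cases k) (simp_all add: eps_in_Inc conv_in_Inc)

text \<open>
  On the incidence algebra, convolution is the ordinary matrix product: by transitivity, the terms
  outside the interval are 0.
\<close>

lemma conv_eq_matrix_product:
  assumes "f \<in> Inc r" "g \<in> Inc r"
  shows "conv r f g x y = (\<Sum>z\<in>Field r. f x z * g z y)"
proof (cases "(x, y) \<in> r")
  case True
  have "(\<Sum>z | (x, z) \<in> r \<and> (z, y) \<in> r. f x z * g z y) = (\<Sum>z\<in>Field r. f x z * g z y)"
    by (rule sum.mono_neutral_left)
       (use assms finite_Field in \<open>auto simp: Inc_def intro: FieldI1 FieldI2\<close>)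
  with True show ?thesis
    by (simp add: conv_def)
next
  case False
  then have "f x z * g z y = 0" for z
    using assms trans_r[of x z y] by (auto simp: Inc_def)
  then show ?thesis
    using False by (simp add: conv_def del: mult_eq_0_iff)
qed

lemma conv_assoc:
  assumes "f \<in> Inc r" "g \<in> Inc r" "h \<in> Inc r"
  shows "conv r (conv r f g) h = conv r f (conv r g h)"
proof (intro ext)
  fix x y
  have "conv r (conv r f g) h x y = (\<Sum>z\<in>Field r. \<Sum>w\<in>Field r. f x w * g w z * h z y)"
    by (simp add: assms conv_in_Inc conv_eq_matrix_product sum_distrib_right)
  also have "\<dots> = (\<Sum>w\<in>Field r. \<Sum>z\<in>Field r. f x w * g w z * h z y)"
    by (rule sum.swap)
  also have "\<dots> = conv r f (conv r g h) x y"
    by (simp add: assms conv_in_Inc conv_eq_matrix_product sum_distrib_left mult.assoc)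
  finally show "conv r (conv r f g) h x y = conv r f (conv r g h) x y" .
qed

lemma conv_eps_left:
  assumes "f \<in> Inc r"
  shows "conv r (eps r) f = f"
proof (intro ext)
  fix x y
  have "conv r (eps r) f x y = (\<Sum>z\<in>Field r. if x = z then f z y else 0)"
    unfolding conv_eq_matrix_product[OF eps_in_Inc assms]
    by (rule sum.cong) (auto simp: eps_def)
  also have "\<dots> = f x y"
    using assms by (auto simp: finite_Field Inc_def intro: FieldI1)
  finally show "conv r (eps r) f x y = f x y" .
qed

lemma conv_eps_right:
  assumes "f \<in> Inc r"
  shows "conv r f (eps r) = f"
proof (intro ext)
  fix x y
  have "conv r f (eps r) x y = (\<Sum>z\<in>Field r. if z = y then f x z else 0)"
    unfolding conv_eq_matrix_product[OF assms eps_in_Inc]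
    by (rule sum.cong) (auto simp: eps_def)
  also have "\<dots> = f x y"
    using assms by (auto simp: finite_Field Inc_def intro: FieldI2)
  finally show "conv r f (eps r) x y = f x y" .
qed

lemma conv_power_add:
  assumes "f \<in> Inc r"
  shows "conv_power r f (m + n) = conv r (conv_power r f m) (conv_power r f n)"
  by (induction n)
     (simp_all add: assms conv_eps_right conv_power_in_Inc conv_assoc)

lemma conv_power_Suc_left:
  assumes "f \<in> Inc r"
  shows "conv_power r f (Suc k) = conv r f (conv_power r f k)"
  using conv_power_add[OF assms, of 1 k] by (simp add: assms conv_eps_left)


section \<open>Nilpotency beyond the height\<close>

text \<open>
  A strict chain visits pairwise different elements, so the lengths of chains are bounded by
  \<open>N\<close>.  This makes the supremum in \<^const>\<open>height\<close> an upper bound; on the natural numbers, the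
  supremum of an unbounded set is a default value.
\<close>

lemma le_height:
  assumes "\<forall>i\<le>k. x i \<in> Field r"
    and steps: "\<forall>i<k. (x i, x (Suc i)) \<in> r \<and> x i \<noteq> x (Suc i)"
  shows "k \<le> height r"
proof -
  let ?H = "{k. \<exists>x :: nat \<Rightarrow> 'a. (\<forall>i\<le>k. x i \<in> Field r) \<and>
               (\<forall>i<k. (x i, x (Suc i)) \<in> r \<and> x i \<noteq> x (Suc i))}"
  have "l \<le> card (Field r)" if "l \<in> ?H" for l
  proof -
    from that obtain c where c: "\<forall>i\<le>l. c i \<in> Field r"
      "\<forall>i<l. (c i, c (Suc i)) \<in> r \<and> c i \<noteq> c (Suc i)"
      by blast
    have less: "(c i, c (i + Suc d)) \<in> r \<and> c i \<noteq> c (i + Suc d)" if "i + Suc d \<le> l" for i d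
      using that
    proof (induction d)
      case 0
      then show ?case using c(2) by simp
    next
      case (Suc d)
      then have "(c i, c (i + Suc d)) \<in> r" "c i \<noteq> c (i + Suc d)"
        "(c (i + Suc d), c (i + Suc (Suc d))) \<in> r"
        using c(2) by auto
      then show ?case
        using trans_r antisym_r by metis
    qed
    have "inj_on c {..l}"
    proof (rule linorder_inj_onI)
      fix i j assume "i < j" "j \<in> {..l}"
      then show "c i \<noteq> c j"
        using less[of i "j - Suc i"] by simp
    qed auto
    then have "card {..l} \<le> card (Field r)"
      by (rule card_inj_on_le) (use c finite_Field in auto)
    then show ?thesis by simp
  qed
  then have "bdd_above ?H"
    by (rule bdd_aboveI)
  moreover have "k \<in> ?H"
    using assms by blast
  ultimately show ?thesis
    unfolding height_def by (rule cSup_upper[rotated])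
qed

lemma chain_if_conv_power_nonzero:
  assumes f: "f \<in> Inc r" "\<And>x. f x x = 0"
    and "conv_power r f k x y \<noteq> 0"
  shows "\<exists>c. c k = y \<and> (\<forall>i\<le>k. c i \<in> Field r) \<and>
             (\<forall>i<k. (c i, c (Suc i)) \<in> r \<and> c i \<noteq> c (Suc i))"
  using assms(3)
proof (induction k arbitrary: y)
  case 0
  then have "y \<in> Field r"
    by (auto simp: eps_def split: if_splits)
  then show ?case
    by (intro exI[of _ "\<lambda>_. y"]) simp
next
  case (Suc k)
  then have "(\<Sum>z\<in>Field r. conv_power r f k x z * f z y) \<noteq> 0"
    by (simp add: conv_eq_matrix_product conv_power_in_Inc f)
  then obtain z where "conv_power r f k x z * f z y \<noteq> 0"
    by (meson sum.not_neutral_contains_not_neutral)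
  then have z: "conv_power r f k x z \<noteq> 0" "f z y \<noteq> 0"
    by simp_all
  then have zy: "(z, y) \<in> r" "z \<noteq> y"
    using f by (auto simp: Inc_def)
  obtain c where "c k = z" "\<forall>i\<le>k. c i \<in> Field r"
    "\<forall>i<k. (c i, c (Suc i)) \<in> r \<and> c i \<noteq> c (Suc i)"
    using Suc.IH[OF z(1)] by blast
  then show ?case
    using zy
    by (intro exI[of _ "c(Suc k := y)"]) (auto simp: le_Suc_eq less_Suc_eq intro: FieldI2)
qed

lemma conv_power_eq_0:
  assumes "f \<in> Inc r" "\<And>x. f x x = 0" "height r < k"
  shows "conv_power r f k = (\<lambda>x y. 0)"
proof (rule ccontr)
  assume "conv_power r f k \<noteq> (\<lambda>x y. 0)"
  then obtain x y where "conv_power r f k x y \<noteq> 0"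
    by (auto simp: fun_eq_iff)
  then have "k \<le> height r"
    using chain_if_conv_power_nonzero[OF assms(1,2)] le_height by metis
  with assms(3) show False by simp
qed


section \<open>The Moebius function as a finite geometric series\<close>

definition delta :: "'a matrix" where
  "delta = (\<lambda>x y. eps r x y - zeta r x y)"

lemma delta_in_Inc: "delta \<in> Inc r"
  unfolding delta_def by (rule diff_in_Inc[OF eps_in_Inc zeta_in_Inc])

lemma delta_diagonal: "delta x x = 0"
  by (auto simp: delta_def eps_def zeta_def refl_r intro: FieldI1)

lemma zeta_eq: "zeta r = (\<lambda>x y. eps r x y - delta x y)"
  by (simp add: delta_def)

lemma delta_power_eta: "conv_power r delta k = (\<lambda>x y. (-1) ^ k * conv_power r (eta r) k x y)"
proof -
  have "delta = (\<lambda>x y. (-1) * eta r x y)"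
    by (simp add: delta_def eta_def)
  then show ?thesis
    by (simp only: conv_power_scale)
qed

lemma delta_power_eq_0: "height r < k \<Longrightarrow> conv_power r delta k = (\<lambda>x y. 0)"
  by (rule conv_power_eq_0[OF delta_in_Inc delta_diagonal])

definition delta_series :: "'a matrix" where
  "delta_series = (\<lambda>x y. \<Sum>k\<le>height r. conv_power r delta k x y)"

lemma delta_series_in_Inc: "delta_series \<in> Inc r"
  unfolding delta_series_def by (intro sum_in_Inc conv_power_in_Inc)

lemma delta_series_telescope:
  "delta_series x y - (\<Sum>k\<le>height r. conv_power r delta (Suc k) x y) = eps r x y"
proof -
  have "delta_series x y - (\<Sum>k\<le>height r. conv_power r delta (Suc k) x y) =
        conv_power r delta 0 x y - conv_power r delta (Suc (height r)) x y"
    unfolding delta_series_def sum_subtractf[symmetric] by (rule sum_telescope)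
  also have "conv_power r delta (Suc (height r)) x y = 0"
    by (subst delta_power_eq_0) simp_all
  finally show ?thesis
    by simp
qed

lemma conv_delta_series_zeta: "conv r delta_series (zeta r) = eps r"
proof -
  have "conv r delta_series delta = (\<lambda>x y. \<Sum>k\<le>height r. conv_power r delta (Suc k) x y)"
    unfolding delta_series_def conv_sum_left by simp
  then show ?thesis
    unfolding zeta_eq conv_diff_right conv_eps_right[OF delta_series_in_Inc]
    by (simp only: delta_series_telescope)
qed

lemma conv_zeta_delta_series: "conv r (zeta r) delta_series = eps r"
proof -
  have "conv r delta delta_series = (\<lambda>x y. \<Sum>k\<le>height r. conv_power r delta (Suc k) x y)"
    unfolding delta_series_def conv_sum_right conv_power_Suc_left[OF delta_in_Inc] ..
  then show ?thesis
    unfolding zeta_eq conv_diff_left conv_eps_left[OF delta_series_in_Inc]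
    by (simp only: delta_series_telescope)
qed

lemma left_inverse_eq_delta_series:
  assumes "g \<in> Inc r" "conv r g (zeta r) = eps r"
  shows "g = delta_series"
proof -
  have "g = conv r g (conv r (zeta r) delta_series)"
    by (simp add: assms conv_zeta_delta_series conv_eps_right)
  also have "\<dots> = conv r (conv r g (zeta r)) delta_series"
    by (rule conv_assoc[OF assms(1) zeta_in_Inc delta_series_in_Inc, symmetric])
  also have "\<dots> = delta_series"
    by (simp add: assms conv_eps_left delta_series_in_Inc)
  finally show ?thesis .
qed

lemma right_inverse_eq_delta_series:
  assumes "g \<in> Inc r" "conv r (zeta r) g = eps r"
  shows "g = delta_series"
proof -
  have "g = conv r (conv r delta_series (zeta r)) g"
    by (simp add: assms conv_delta_series_zeta conv_eps_left)
  also have "\<dots> = conv r delta_series (conv r (zeta r) g)"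
    by (simp add: assms conv_assoc zeta_in_Inc delta_series_in_Inc)
  also have "\<dots> = delta_series"
    by (simp add: assms conv_eps_right delta_series_in_Inc)
  finally show ?thesis .
qed

lemma mobius_eq_delta_series: "mobius r = delta_series"
  unfolding mobius_def
  by (rule the_equality)
     (auto simp: conv_zeta_delta_series conv_delta_series_zeta delta_series_in_Inc
       intro: left_inverse_eq_delta_series)

lemmas left_inverse_eq_mobius = left_inverse_eq_delta_series[folded mobius_eq_delta_series]
lemmas right_inverse_eq_mobius = right_inverse_eq_delta_series[folded mobius_eq_delta_series]

lemma mobius_eq_sum_eta:
  "mobius r = (\<lambda>x y. \<Sum>k\<le>height r. (-1) ^ k * conv_power r (eta r) k x y)"
  by (simp only: mobius_eq_delta_series delta_series_def delta_power_eta)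

end


section \<open>The direct formula\<close>

lemma result_return: "result (return x) = x"
  and cost_return: "cost (return x) = 0"
  and result_bind: "result (m \<bind> f) = result (f (result m))"
  and cost_bind: "cost (m \<bind> f) = cost m + cost (f (result m))"
  by (simp_all add: return_def bind_def)

lemmas counted_simps = result_return cost_return result_bind cost_bind case_prod_beta

lemma result_power_sum:
  "result (power_sum pc r e k) =
     (conv_power r e k, \<lambda>x y. \<Sum>i\<le>k. (-1) ^ i * conv_power r e i x y)"
  by (induction k)
     (auto simp: counted_simps inc_mult_def inc_add_def inc_sub_def fun_eq_iff)

lemma cost_power_sum: "cost (power_sum pc r e k) = k * (pc r + card r)"
  by (induction k)
     (simp_all add: counted_simps inc_mult_def inc_add_def inc_sub_def)

lemma (in finite_poset) result_direct_mobius: "result (direct_mobius pc r) = mobius r"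
  unfolding direct_mobius_def mobius_eq_sum_eta
  by (simp add: counted_simps result_power_sum inc_sub_def eta_def)

lemma cost_direct_mobius_le:
  "cost (direct_mobius pc r) \<le> height r * (pc r + 2 * card r)"
proof (cases "height r = 0")
  case False
  then have "card r \<le> height r * card r"
    by simp
  then show ?thesis
    using False
    by (simp add: direct_mobius_def counted_simps cost_power_sum inc_sub_def algebra_simps)
qed (simp add: direct_mobius_def counted_simps)


section \<open>Newton's iteration\<close>

context finite_poset
begin

lemma newton_iterate_in_Inc: "result (newton_iterate pc r k) \<in> Inc r"
  by (cases k) (simp_all add: counted_simps eps_in_Inc inc_mult_def conv_in_Inc)

text \<open>
  With \<open>t = \<zeta> * g\<close>, the next value of \<open>\<zeta> * g\<close> is \<open>2 t - t * t\<close>, so the error is squared: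
  \<open>\<epsilon> - (2 t - t * t) = (\<epsilon> - t) * (\<epsilon> - t)\<close>.
\<close>

lemma newton_error:
  "(\<lambda>x y. eps r x y - conv r (zeta r) (result (newton_iterate pc r k)) x y) =
   conv_power r delta (2 ^ k)"
proof (induction k)
  case 0
  show ?case
    by (simp add: counted_simps conv_eps_right conv_eps_left zeta_in_Inc delta_in_Inc)
       (simp add: delta_def)
next
  case (Suc k)
  define g where "g = result (newton_iterate pc r k)"
  define t where "t = conv r (zeta r) g"
  have g: "g \<in> Inc r"
    unfolding g_def by (rule newton_iterate_in_Inc)
  have t: "t \<in> Inc r"
    unfolding t_def by (rule conv_in_Inc)
  have u: "(\<lambda>x y. 2 * eps r x y - t x y) \<in> Inc r"
    using eps_in_Inc t by (simp add: Inc_def)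
  have "conv r (zeta r) (result (newton_iterate pc r (Suc k))) =
        conv r (zeta r) (conv r g (\<lambda>x y. 2 * eps r x y - t x y))"
    by (simp add: counted_simps inc_mult_def inc_sub_def g_def t_def)
  also have "\<dots> = conv r t (\<lambda>x y. 2 * eps r x y - t x y)"
    unfolding t_def by (rule conv_assoc[symmetric]) (use zeta_in_Inc g u t_def in auto)
  also have "\<dots> = (\<lambda>x y. 2 * t x y - conv r t t x y)"
    by (simp add: conv_diff_right conv_scale_right conv_eps_right t)
  finally have "(\<lambda>x y. eps r x y - conv r (zeta r) (result (newton_iterate pc r (Suc k))) x y) =
        conv r (\<lambda>x y. eps r x y - t x y) (\<lambda>x y. eps r x y - t x y)"
    by (simp add: conv_diff_left conv_diff_right conv_eps_left conv_eps_right t eps_in_Inc fun_eq_iff)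
  also have "(\<lambda>x y. eps r x y - t x y) = conv_power r delta (2 ^ k)"
    unfolding t_def g_def by (rule Suc.IH)
  also have "conv r (conv_power r delta (2 ^ k)) (conv_power r delta (2 ^ k)) =
        conv_power r delta (2 ^ Suc k)"
    by (simp add: conv_power_add[OF delta_in_Inc, symmetric] mult_2)
  finally show ?case .
qed

lemma result_newton_mobius: "result (newton_mobius pc r) = mobius r"
proof -
  define k where "k = nat \<lceil>log 2 (real (height r) + 1)\<rceil>"
  have "log 2 (real (height r) + 1) \<le> real k"
    unfolding k_def by linarith
  then have "real (height r) + 1 \<le> 2 powr real k"
    by (subst (asm) log_le_iff) auto
  then have "real (height r + 1) \<le> real (2 ^ k)"
    by (simp add: powr_realpow)
  then have "height r < 2 ^ k"
    unfolding of_nat_le_iff by simp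
  then have "conv r (zeta r) (result (newton_iterate pc r k)) = eps r"
    using newton_error[of pc k] delta_power_eq_0 by (simp add: fun_eq_iff)
  then show ?thesis
    unfolding newton_mobius_def k_def[symmetric]
    using right_inverse_eq_mobius newton_iterate_in_Inc by simp
qed

end

lemma cost_newton_iterate: "cost (newton_iterate pc r k) = k * (2 * pc r + card r)"
  by (induction k) (simp_all add: counted_simps inc_mult_def inc_sub_def)

text \<open>
  Rounding up adds at most 1, which is at most \<open>log 2 (h + 1)\<close> if \<open>h \<ge> 1\<close>; if \<open>h = 0\<close>, both sides
  are 0.
\<close>

lemma newton_steps_le: "real (nat \<lceil>log 2 (real h + 1)\<rceil>) \<le> 2 * log 2 (real h + 1)"
proof (cases "h = 0")
  case False
  then have "log 2 2 \<le> log 2 (real h + 1)"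
    by (intro log_mono) auto
  then have "1 \<le> log 2 (real h + 1)"
    by simp
  then show ?thesis
    by linarith
qed simp


section \<open>Gaussian inversion\<close>

lemma result_for_each:
  "result (for_each is body s) = fold (\<lambda>i s. result (body i s)) is s"
  by (induction "is" arbitrary: s) (simp_all add: counted_simps)

lemma cost_for_each_le:
  assumes "\<And>i s. i \<in> set is \<Longrightarrow> cost (body i s) \<le> c"
  shows "cost (for_each is body s) \<le> length is * c"
  using assms
proof (induction "is" arbitrary: s)
  case (Cons i "is")
  have "cost (body i s) \<le> c"
    by (simp add: Cons.prems)
  moreover have "cost (for_each is body (result (body i s))) \<le> length is * c"
    by (rule Cons.IH) (simp add: Cons.prems)
  ultimately show ?case
    by (simp add: counted_simps)
qed (simp add: counted_simps)

lemma result_divide_row: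
  assumes "distinct xs"
  shows "result (divide_row xs p k A) =
         (\<lambda>a j. if a = k \<and> j \<in> set xs then A a j / p else A a j)"
  using assms unfolding divide_row_def result_for_each
  by (induction xs arbitrary: A)
     (auto simp: counted_simps quot_def set_entry_def fun_eq_iff)

lemma result_subtract_row:
  assumes "distinct xs" "i \<noteq> k"
  shows "result (subtract_row xs c k i A) =
         (\<lambda>a j. if a = i \<and> j \<in> set xs then A a j - c * A k j else A a j)"
  using assms unfolding subtract_row_def result_for_each
  by (induction xs arbitrary: A)
     (auto simp: counted_simps mul_def sub_def set_entry_def fun_eq_iff)

text \<open>
  The loop over the rows acts on all of them independently: row \<open>k\<close> is not changed by it, and the
  multiplier of row \<open>a\<close> is read before row \<open>a\<close> is changed.
\<close>

lemma result_subtract_rows: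
  assumes "distinct xs" "distinct is" "k \<notin> set is"
  shows "result (for_each is
       (\<lambda>i (A, B). subtract_row xs (A i k) k i A \<bind> (\<lambda>A'.
                    subtract_row xs (A i k) k i B \<bind> (\<lambda>B'. return (A', B')))) (A, B)) =
     (\<lambda>a j. if a \<in> set is \<and> j \<in> set xs then A a j - A a k * A k j else A a j,
      \<lambda>a j. if a \<in> set is \<and> j \<in> set xs then B a j - A a k * B k j else B a j)"
  using assms(2,3)
proof (induction "is" arbitrary: A B)
  case Nil
  then show ?case by (simp add: counted_simps)
next
  case (Cons i "is")
  then have "i \<noteq> k" by auto
  then show ?case
    using Cons assms(1)
    by (auto simp: result_for_each counted_simps result_subtract_row fun_eq_iff)
qed

text \<open>The effect of \<^const>\<open>pivot_step\<close> on one half of the augmented matrix, for a pivot 1.\<close>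

definition clear_column :: "'a matrix \<Rightarrow> 'a \<Rightarrow> 'a matrix \<Rightarrow> 'a matrix" where
  "clear_column A k F = (\<lambda>a j. if a = k then F a j else F a j - A a k * F k j)"

context finite_poset
begin

text \<open>
  By transitivity, \<open>A a k * F k j\<close> is nonzero only if \<open>(a, j)\<close> is in the order.
\<close>

lemma clear_column_in_Inc:
  assumes "A \<in> Inc r" "F \<in> Inc r"
  shows "clear_column A k F \<in> Inc r"
  using assms trans_r by (fastforce simp: Inc_def clear_column_def)

text \<open>A row operation acts on the left, so it commutes with multiplication on the right.\<close>

lemma conv_clear_column:
  assumes "A \<in> Inc r" "F \<in> Inc r" "G \<in> Inc r"
  shows "conv r (clear_column A k F) G = clear_column A k (conv r F G)"
  by (auto simp: fun_eq_iff conv_eq_matrix_product assms clear_column_in_Inc)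
     (simp add: clear_column_def conv_eq_matrix_product assms left_diff_distrib sum_subtractf
        sum_distrib_left mult.assoc)

lemma result_pivot_step:
  assumes xs: "distinct xs" "set xs = Field r"
    and A: "A \<in> Inc r" and B: "B \<in> Inc r" and pivot: "A k k = 1"
  shows "result (pivot_step xs k (A, B)) = (clear_column A k A, clear_column A k B)"
proof -
  have zero: "F a j = 0" if "F \<in> Inc r" "a \<notin> Field r \<or> j \<notin> Field r" for F a j
    using that by (auto simp: Inc_def intro: FieldI1 FieldI2)
  have k: "k \<notin> set (filter (\<lambda>i. i \<noteq> k) xs)" and d: "distinct (filter (\<lambda>i. i \<noteq> k) xs)"
    using xs by auto
  have "result (divide_row xs (A k k) k F) = F" for F
    by (simp add: result_divide_row xs pivot fun_eq_iff)
  then show ?thesis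
    using zero[OF A] zero[OF B]
    by (auto simp: pivot_step_def result_bind result_subtract_rows[OF xs(1) d k]
          clear_column_def fun_eq_iff xs(2))
qed

text \<open>
  \<open>D\<close> is the set of the columns cleared so far.  The unit diagonal makes every pivot equal to 1.
\<close>

definition gauss_invariant :: "'a set \<Rightarrow> 'a matrix \<times> 'a matrix \<Rightarrow> bool" where
  "gauss_invariant D = (\<lambda>(A, B). A \<in> Inc r \<and> B \<in> Inc r \<and> conv r B (zeta r) = A \<and>
     (\<forall>x\<in>Field r. A x x = 1) \<and> (\<forall>x. \<forall>y\<in>D. x \<noteq> y \<longrightarrow> A x y = 0))"

lemma gauss_invariant_pivot_step:
  assumes xs: "distinct xs" "set xs = Field r"
    and inv: "gauss_invariant D (A, B)" and k: "k \<in> Field r" "k \<notin> D"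
  shows "gauss_invariant (insert k D) (result (pivot_step xs k (A, B)))"
proof -
  from inv have A: "A \<in> Inc r" and B: "B \<in> Inc r" and BA: "conv r B (zeta r) = A"
    and diag: "\<And>x. x \<in> Field r \<Longrightarrow> A x x = 1"
    and cleared: "\<And>x y. y \<in> D \<Longrightarrow> x \<noteq> y \<Longrightarrow> A x y = 0"
    by (auto simp: gauss_invariant_def)
  have "A x k * A k x = 0" if "x \<noteq> k" for x
    using that A antisym_r[of x k] by (auto simp: Inc_def)
  then have "clear_column A k A x x = 1" if "x \<in> Field r" for x
    using that diag by (auto simp: clear_column_def)
  moreover have "clear_column A k A x y = 0" if "y \<in> insert k D" "x \<noteq> y" for x y
  proof (cases "y = k")
    case True
    with that show ?thesis
      using diag[OF k(1)] by (simp add: clear_column_def)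
  next
    case False
    with that show ?thesis
      using cleared[of y x] cleared[of y k] by (auto simp: clear_column_def)
  qed
  moreover have "conv r (clear_column A k B) (zeta r) = clear_column A k A"
    by (simp add: conv_clear_column A B BA zeta_in_Inc)
  ultimately show ?thesis
    using A B clear_column_in_Inc result_pivot_step[OF xs A B diag[OF k(1)]]
    by (auto simp: gauss_invariant_def)
qed

lemma gauss_invariant_for_each:
  assumes xs: "distinct xs" "set xs = Field r"
  shows "distinct ks \<Longrightarrow> set ks \<subseteq> Field r \<Longrightarrow> set ks \<inter> D = {} \<Longrightarrow> gauss_invariant D S \<Longrightarrow>
    gauss_invariant (set ks \<union> D) (result (for_each ks (pivot_step xs) S))"
proof (induction ks arbitrary: D S)
  case Nil
  then show ?case by (simp add: counted_simps)
next
  case (Cons k ks)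
  have "gauss_invariant (insert k D) (result (pivot_step xs k S))"
    using gauss_invariant_pivot_step[OF xs, of D "fst S" "snd S" k] Cons.prems by simp
  then have "gauss_invariant (set ks \<union> insert k D)
      (result (for_each ks (pivot_step xs) (result (pivot_step xs k S))))"
    using Cons.prems by (intro Cons.IH) auto
  then show ?case
    by (simp add: counted_simps)
qed

lemma result_gauss_mobius:
  assumes "linear_extension r xs"
  shows "result (gauss_mobius r xs) = mobius r"
proof -
  have xs: "distinct xs" "set xs = Field r"
    using assms by (simp_all add: linear_extension_def)
  have "gauss_invariant {} (zeta r, eps r)"
    by (simp add: gauss_invariant_def zeta_in_Inc eps_in_Inc conv_eps_left)
       (simp add: zeta_def refl_r)
  then have "gauss_invariant (set xs \<union> {}) (result (for_each xs (pivot_step xs) (zeta r, eps r)))"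
    using xs by (intro gauss_invariant_for_each) auto
  moreover obtain A B where AB: "result (for_each xs (pivot_step xs) (zeta r, eps r)) = (A, B)"
    by fastforce
  ultimately have inv: "gauss_invariant (Field r) (A, B)"
    using xs by simp
  then have "A x y = eps r x y" for x y
    by (cases "y \<in> Field r") (auto simp: gauss_invariant_def eps_def Inc_def intro: FieldI2)
  then have "A = eps r"
    by (simp add: fun_eq_iff)
  then have "B = mobius r"
    using inv by (intro left_inverse_eq_mobius) (auto simp: gauss_invariant_def)
  then show ?thesis
    by (simp add: gauss_mobius_def counted_simps AB)
qed

end

lemma cost_divide_row_le: "cost (divide_row xs p k A) \<le> length xs"
  unfolding divide_row_def
  by (rule order_trans[OF cost_for_each_le[where c = 1]]) (simp_all add: counted_simps quot_def)

lemma cost_subtract_row_le: "cost (subtract_row xs c k i A) \<le> length xs * 2"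
  unfolding subtract_row_def
  by (rule cost_for_each_le) (simp add: counted_simps mul_def sub_def)

lemma cost_pivot_step_le: "cost (pivot_step xs k S) \<le> 6 * length xs ^ 2"
proof -
  let ?n = "length xs"
  let ?body = "\<lambda>i (A, B). subtract_row xs (A i k) k i A \<bind> (\<lambda>A'.
                    subtract_row xs (A i k) k i B \<bind> (\<lambda>B'. return (A', B')))"
  have "cost (?body i T) \<le> 4 * ?n" for i T
    using cost_subtract_row_le[of xs "fst T i k" k i "fst T"]
      cost_subtract_row_le[of xs "fst T i k" k i "snd T"]
    by (simp add: counted_simps)
  then have "cost (for_each (filter (\<lambda>i. i \<noteq> k) xs) ?body T) \<le>
      length (filter (\<lambda>i. i \<noteq> k) xs) * (4 * ?n)" for T
    by (rule cost_for_each_le)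
  then have rows: "cost (for_each (filter (\<lambda>i. i \<noteq> k) xs) ?body T) \<le> ?n * (4 * ?n)" for T
    using mult_le_mono1[OF length_filter_le] order_trans by blast
  obtain A B where S: "S = (A, B)"
    by fastforce
  have "cost (pivot_step xs k S) \<le> ?n + (?n + ?n * (4 * ?n))"
    unfolding S pivot_step_def cost_bind case_prod_conv
    by (intro add_mono cost_divide_row_le rows)
  also have "\<dots> \<le> 6 * ?n ^ 2"
    using le_square[of ?n] by (simp only: power2_eq_square)
  finally show ?thesis .
qed

lemma cost_gauss_mobius_le: "cost (gauss_mobius r xs) \<le> 6 * length xs ^ 3"
proof -
  have "cost (gauss_mobius r xs) \<le> length xs * (6 * length xs ^ 2)"
    by (simp add: gauss_mobius_def counted_simps cost_for_each_le cost_pivot_step_le)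
  then show ?thesis
    by (simp add: power2_eq_square power3_eq_cube mult_ac)
qed


section \<open>The three methods\<close>


theorem theoremM3:
  fixes pc :: "'a rel \<Rightarrow> nat"
  assumes "(\<lambda>r. real (pc r)) \<in> O[principal finite_posets](\<lambda>r. real (card (Field r)) ^ 2)"
  shows
    "((\<forall>r \<in> (finite_posets :: 'a rel set). \<forall>xs. linear_extension r xs \<longrightarrow>
        result (gauss_mobius r xs) = mobius r) \<and>
     (\<lambda>(r :: 'a rel, xs). real (cost (gauss_mobius r xs)))
       \<in> O[principal {(r, xs). r \<in> finite_posets \<and> linear_extension r xs}](\<lambda>(r, xs). real (card (Field r)) ^ 3)) \<and>
     ((\<forall>r \<in> (finite_posets :: 'a rel set).
        mobius r = (\<lambda>x y. \<Sum>k\<le>height r. (-1) ^ k * conv_power r (eta r) k x y) \<and>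
        result (direct_mobius pc r) = mobius r) \<and>
     (\<lambda>r. real (cost (direct_mobius pc r)))
       \<in> O[principal finite_posets](\<lambda>r. real (height r) * real (card (Field r)) ^ 2)) \<and>
     ((\<forall>r \<in> (finite_posets :: 'a rel set). result (newton_mobius pc r) = mobius r) \<and>
     (\<lambda>r. real (cost (newton_mobius pc r)))
       \<in> O[principal finite_posets](\<lambda>r. log 2 (real (height r) + 1) * real (card (Field r)) ^ 2) \<and>
     (\<lambda>r. real (cost (newton_mobius pc r)))
       \<in> O[principal {r \<in> finite_posets. 2 \<le> height r}](\<lambda>r. log 2 (real (height r)) * real (card (Field r)) ^ 2))"
proof -
  have poset: "finite_poset r" if "r \<in> finite_posets" for r :: "'a rel"
    using that by (rule finite_poset.intro)
  obtain c where "c > 0"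
    and c: "\<And>r. r \<in> finite_posets \<Longrightarrow> real (pc r) \<le> c * real (card (Field r)) ^ 2"
    using assms by (auto elim!: landau_o.bigE simp: eventually_principal)
  have card_r: "real (card r) \<le> real (card (Field r)) ^ 2" if "r \<in> finite_posets" for r :: "'a rel"
    using finite_poset.card_r_le[OF poset[OF that]] by (metis of_nat_le_iff of_nat_power)

  have gauss: "(\<lambda>(r :: 'a rel, xs). real (cost (gauss_mobius r xs)))
    \<in> O[principal {(r, xs). r \<in> finite_posets \<and> linear_extension r xs}](\<lambda>(r, xs). real (card (Field r)) ^ 3)"
  proof (rule bigoI[of _ 6], unfold eventually_principal, clarsimp)
    fix r :: "'a rel" and xs
    assume "linear_extension r xs"
    then have "length xs = card (Field r)"
      by (metis linear_extension_def distinct_card)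
    then have "cost (gauss_mobius r xs) \<le> 6 * card (Field r) ^ 3"
      using cost_gauss_mobius_le[of r xs] by simp
    then have "real (cost (gauss_mobius r xs)) \<le> real (6 * card (Field r) ^ 3)"
      by (rule of_nat_mono)
    then show "real (cost (gauss_mobius r xs)) \<le> 6 * real (card (Field r)) ^ 3"
      by simp
  qed

  have direct: "(\<lambda>r. real (cost (direct_mobius pc r)))
    \<in> O[principal finite_posets](\<lambda>r. real (height r) * real (card (Field r)) ^ 2)"
  proof (rule bigoI[of _ "c + 2"], unfold eventually_principal, clarsimp)
    fix r :: "'a rel" assume r: "r \<in> finite_posets"
    have "real (cost (direct_mobius pc r)) \<le> real (height r * (pc r + 2 * card r))"
      by (rule of_nat_mono[OF cost_direct_mobius_le])
    also have "\<dots> = real (height r) * (real (pc r) + 2 * real (card r))"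
      by simp
    also have "\<dots> \<le> real (height r) * ((c + 2) * real (card (Field r)) ^ 2)"
      unfolding distrib_right by (intro mult_left_mono add_mono c card_r r) simp_all
    finally show "real (cost (direct_mobius pc r)) \<le>
        (c + 2) * (real (height r) * real (card (Field r)) ^ 2)"
      by (simp add: mult_ac)
  qed

  have newton_le: "real (cost (newton_mobius pc r)) \<le>
      (4 * c + 2) * (log 2 (real (height r) + 1) * real (card (Field r)) ^ 2)"
    if r: "r \<in> finite_posets" for r
  proof -
    have step: "2 * real (pc r) + real (card r) \<le> (2 * c + 1) * real (card (Field r)) ^ 2"
      using c[OF r] card_r[OF r] by (simp only: distrib_right mult.assoc)
    have "real (cost (newton_mobius pc r)) =
        real (nat \<lceil>log 2 (real (height r) + 1)\<rceil>) * (2 * real (pc r) + real (card r))"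
      unfolding newton_mobius_def cost_newton_iterate by simp
    also have "\<dots> \<le> (2 * log 2 (real (height r) + 1)) * ((2 * c + 1) * real (card (Field r)) ^ 2)"
      using step by (intro mult_mono newton_steps_le) simp_all
    finally show ?thesis
      by (simp add: algebra_simps)
  qed
  have log_nonneg: "0 \<le> log 2 (real h + 1)" for h
    by simp
  have newton: "(\<lambda>r. real (cost (newton_mobius pc r)))
    \<in> O[principal finite_posets](\<lambda>r. log 2 (real (height r) + 1) * real (card (Field r)) ^ 2)"
    by (rule bigoI[of _ "4 * c + 2"])
       (use newton_le log_nonneg in \<open>auto simp: eventually_principal abs_mult\<close>)
  have newton': "(\<lambda>r. real (cost (newton_mobius pc r)))
    \<in> O[principal {r \<in> finite_posets. 2 \<le> height r}](\<lambda>r. log 2 (real (height r)) * real (card (Field r)) ^ 2)"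
  proof (rule bigoI[of _ "2 * (4 * c + 2)"], unfold eventually_principal, rule ballI)
    fix r :: "'a rel" assume "r \<in> {r \<in> finite_posets. 2 \<le> height r}"
    then have r: "r \<in> finite_posets" and h: "2 \<le> height r"
      by simp_all
    define h where "h = real (height r)"
    have "2 \<le> h"
      using h unfolding h_def by simp
    then have "h + 1 \<le> h ^ 2"
      using mult_right_mono[of 2 h h] unfolding power2_eq_square by linarith
    then have "log 2 (h + 1) \<le> log 2 (h ^ 2)"
      using \<open>2 \<le> h\<close> by (intro log_mono) auto
    also have "\<dots> = 2 * log 2 h"
      using \<open>2 \<le> h\<close> by (simp add: log_nat_power)
    finally have "(4 * c + 2) * (log 2 (h + 1) * real (card (Field r)) ^ 2) \<le>
        (4 * c + 2) * ((2 * log 2 h) * real (card (Field r)) ^ 2)"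
      using \<open>c > 0\<close> by (intro mult_left_mono mult_right_mono) auto
    moreover have "\<bar>log 2 h\<bar> = log 2 h"
      using \<open>2 \<le> h\<close> by simp
    ultimately show "norm (real (cost (newton_mobius pc r))) \<le>
        2 * (4 * c + 2) * norm (log 2 (real (height r)) * real (card (Field r)) ^ 2)"
      using newton_le[OF r] unfolding h_def by (simp add: abs_mult algebra_simps)
  qed

  show ?thesis
    using gauss direct newton newton' poset finite_poset.result_gauss_mobius
      finite_poset.mobius_eq_sum_eta finite_poset.result_direct_mobius
      finite_poset.result_newton_mobius
    by blast
qed

end
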